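(* Let $n\ge 2$ be an even integer, let $\mathcal{A}$ be a unital algebra over a commutative unital ring $\mathcal{R}$ with a nontrivial idempotent $e$, and put $f=1-e$. Suppose that $\mathcal{A}$ is $2$- and $(n-1)$-torsion free, and that for each $x\in\mathcal{A}$: $exe\cdot e\mathcal{A}f=\{0\}=f\mathcal{A}e\cdot exe$ implies $exe=0$, and $e\mathcal{A}f\cdot fxf=\{0\}=fxf\cdot f\mathcal{A}e$ implies $fxf=0$. Let $\varphi$ be a Lie $n$-derivation on $\mathcal{A}$. Then $\varphi$ is standard if and only if both of the following hold: (i) $f\varphi(e\mathcal{A}e)f\subseteq f\mathcal{Z}(\mathcal{A})f$ and $e\varphi(f\mathcal{A}f)e\subseteq e\mathcal{Z}(\mathcal{A})e$; (ii) $e\varphi(tm)e+f\varphi(mt)f\in\mathcal{Z}(\mathcal{A})$ for each $m\in e\mathcal{A}f$ and $t\in f\mathcal{A}e$.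
   Context: Linear means $\mathcal{R}$-linear; $\mathcal{Z}(\mathcal{A})$ is the centre. Nontrivial idempotent: $e^2=e$, $e\ne 0,1$. For a positive integer $k$, $\mathcal{A}$ is $k$-torsion free if $kx=0$ implies $x=0$ for each $x\in\mathcal{A}$. $[x,y]=xy-yx$. Define $p_1(x_1)=x_1$ and $p_n(x_1,\dots,x_n)=[p_{n-1}(x_1,\dots,x_{n-1}),x_n]$ for $n\ge2$; for $n\ge 2$, $p_n(x_1,\dots,x_n)$ is called an $(n-1)$-th commutator. A linear map $\varphi:\mathcal{A}\to\mathcal{A}$ is a Lie $n$-derivation if $\varphi(p_n(x_1,\dots,x_n))=\sum_{i=1}^n p_n(x_1,\dots,x_{i-1},\varphi(x_i),x_{i+1},\dots,x_n)$ for all $x_1,\dots,x_n\in\mathcal{A}$. A Lie $n$-derivation is standard if it equals $h+\tau$ with $h$ a derivation on $\mathcal{A}$ (linear, $h(xy)=h(x)y+xh(y)$) and $\tau$ a linear mapping from $\mathcal{A}$ into $\mathcal{Z}(\mathcal{A})$ vanishing on all $(n-1)$-th commutators of $\mathcal{A}$. *)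

theory Defs
  imports Complex_Main
begin

text \<open>
  The algebra is the type \<open>'a :: ring_1\<close> (unital, not necessarily commutative) with an action
  of a commutative unital ring \<open>'r\<close>.
\<close>

locale unital_algebra = module scale
  for scale :: "'r::comm_ring_1 \<Rightarrow> 'a::ring_1 \<Rightarrow> 'a" +
  assumes scale_mult_left: "scale r (x * y) = scale r x * y"
    and scale_mult_right: "scale r (x * y) = x * scale r y"

definition centre :: "'a::ring_1 set" where
  "centre = {z. \<forall>x. z * x = x * z}"

definition nontrivial_idempotent :: "'a::ring_1 \<Rightarrow> bool" where
  "nontrivial_idempotent e \<longleftrightarrow> e * e = e \<and> e \<noteq> 0 \<and> e \<noteq> 1"

definition torsion_free :: "nat \<Rightarrow> 'a::ring_1 itself \<Rightarrow> bool" where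
  "torsion_free k _ \<longleftrightarrow> (\<forall>x::'a. of_nat k * x = 0 \<longrightarrow> x = 0)"

text \<open>
  \<open>sandwich u S v\<close> is \<open>uSv\<close>; it is the set of products, not its linear span.
\<close>

definition sandwich :: "'a::ring_1 \<Rightarrow> 'a set \<Rightarrow> 'a \<Rightarrow> 'a set" where
  "sandwich u S v = (\<lambda>x. u * x * v) ` S"

definition lie_bracket :: "'a::ring_1 \<Rightarrow> 'a \<Rightarrow> 'a" where
  "lie_bracket x y = x * y - y * x"

text \<open>
  \<open>pcomm n x\<close> is \<open>p\<^sub>n(x\<^sub>1, \<dots>, x\<^sub>n)\<close>. The arguments are indexed from 1 and given as a sequence
  \<open>x\<close>, of which only the entries \<open>x 1, \<dots>, x n\<close> matter; the value at \<open>n = 0\<close> is a dummy.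
\<close>

fun pcomm :: "nat \<Rightarrow> (nat \<Rightarrow> 'a::ring_1) \<Rightarrow> 'a" where
  "pcomm 0 x = 0"
| "pcomm (Suc 0) x = x 1"
| "pcomm (Suc (Suc n)) x = lie_bracket (pcomm (Suc n) x) (x (Suc (Suc n)))"

definition lie_n_derivation ::
  "('r::comm_ring_1 \<Rightarrow> 'a::ring_1 \<Rightarrow> 'a) \<Rightarrow> nat \<Rightarrow> ('a \<Rightarrow> 'a) \<Rightarrow> bool" where
  "lie_n_derivation scale n \<phi> \<longleftrightarrow> module_hom scale scale \<phi> \<and>
     (\<forall>x. \<phi> (pcomm n x) = (\<Sum>i=1..n. pcomm n (x(i := \<phi> (x i)))))"

definition derivation ::
  "('r::comm_ring_1 \<Rightarrow> 'a::ring_1 \<Rightarrow> 'a) \<Rightarrow> ('a \<Rightarrow> 'a) \<Rightarrow> bool" where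
  "derivation scale h \<longleftrightarrow> module_hom scale scale h \<and>
     (\<forall>x y. h (x * y) = h x * y + x * h y)"

text \<open>
  The \<open>(n-1)\<close>-th commutators are exactly the elements of \<open>range (pcomm n)\<close>.
\<close>

definition standard ::
  "('r::comm_ring_1 \<Rightarrow> 'a::ring_1 \<Rightarrow> 'a) \<Rightarrow> nat \<Rightarrow> ('a \<Rightarrow> 'a) \<Rightarrow> bool" where
  "standard scale n \<phi> \<longleftrightarrow> lie_n_derivation scale n \<phi> \<and>
     (\<exists>h \<tau>. derivation scale h \<and>
        module_hom scale scale \<tau> \<and> range \<tau> \<subseteq> centre \<and> (\<forall>c \<in> range (pcomm n). \<tau> c = 0) \<and>
        (\<forall>x. \<phi> x = h x + \<tau> x))"

end

theory Submission
  imports Defs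
begin

text \<open>
  Write \<open>A\<close> for the algebra. The idempotent splits it into the Peirce corners \<open>eAe\<close>, \<open>eAf\<close>,
  \<open>fAe\<close>, \<open>fAf\<close>, and the whole argument rests on feeding the Lie identity with commutators in which
  almost all entries are idempotents, because then \<open>p\<^sub>n\<close> collapses: \<open>p\<^sub>n(m, f, \<dots>, f, y) = [m, y]\<close>
  for \<open>m\<close> in \<open>eAf\<close>, and \<open>p\<^sub>n(y, f, \<dots>, f) = [y, f]\<close> for every \<open>y\<close> since \<open>n\<close> is even and
  \<open>z \<mapsto> [z, f]\<close> equals its own cube.

  Necessity is a corner computation. A derivation \<open>h\<close> maps \<open>eAe\<close> to elements \<open>x\<close> with \<open>fxf = 0\<close>,
  so there \<open>\<phi>\<close> contributes to the opposite corner only through the central part \<open>\<tau>\<close>; and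
  \<open>\<tau>(mt) = \<tau>(tm)\<close> because \<open>[m, t]\<close> is an iterated commutator.

  For sufficiency, subtracting an inner derivation makes \<open>\<phi>(e)\<close> diagonal, which affects neither
  of the two conditions. Applying \<open>\<phi>\<close> to \<open>p\<^sub>n(m, f, \<dots>, f) = m\<close> gives
  \<open>\<phi>(m) = [\<phi>(m), f] + (n - 1)[m, \<phi>(f)]\<close>. Comparing corners, \<open>2\<close>-torsion freeness kills the
  \<open>fAe\<close> part of \<open>\<phi>(m)\<close> and \<open>(n - 1)\<close>-torsion freeness yields \<open>[m, \<phi>(f)] = 0\<close>
  (\<open>phi_ef_and_bracket\<close>). Hence \<open>\<phi>\<close> preserves both off-diagonal corners, \<open>\<phi>(e)\<close> and \<open>\<phi>(f)\<close> are
  central, and \<open>\<phi>\<close> maps diagonal elements to diagonal ones.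

  A central element is determined by either of its diagonal corners (\<open>centre_eq_0\<close>). So the first
  condition assigns to \<open>x\<close> in \<open>eAe\<close> a unique central \<open>\<tau>(x)\<close> with the same \<open>f\<close>-corner as
  \<open>\<phi>(x)\<close>, and likewise on \<open>fAf\<close>; with \<open>\<tau> = 0\<close> off the diagonal, \<open>h = \<phi> - \<tau>\<close> preserves every
  corner and vanishes at \<open>f\<close>. Applying \<open>\<phi>\<close> to \<open>p\<^sub>n(m, f, \<dots>, f, y)\<close> therefore leaves
  \<open>\<phi>([m, y]) = [h(m), y] + [m, h(y)]\<close> (\<open>phi_bracket_ef\<close>), from which the product rule follows when
  one factor is off-diagonal and the other diagonal. Faithfulness propagates it to two elements of
  \<open>eAe\<close>. For \<open>m\<close> in \<open>eAf\<close> and \<open>t\<close> in \<open>fAe\<close> it needs \<open>\<tau>(mt) = \<tau>(tm)\<close>, and that is what the second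
  condition says (\<open>tau_cross\<close>). Finally \<open>\<tau>\<close> kills iterated commutators because \<open>h\<close>, being a
  derivation, satisfies the same Lie identity as \<open>\<phi>\<close>.

  All hypotheses are invariant under exchanging \<open>e\<close> and \<open>f\<close>. Each locale below records this as a
  lemma, so only one of two mirror images is ever computed.
\<close>

section \<open>Iterated commutators\<close>

lemma pcomm_Suc: "n \<ge> 1 \<Longrightarrow> pcomm (Suc n) x = lie_bracket (pcomm n x) (x (Suc n))"
  by (cases n) auto

lemma pcomm_cong:
  assumes "\<And>i. 1 \<le> i \<Longrightarrow> i \<le> n \<Longrightarrow> x i = y i"
  shows "pcomm n x = pcomm n y"
  using assms by (induction n x rule: pcomm.induct) auto

lemma lie_bracket_zero [simp]: "lie_bracket 0 x = 0" "lie_bracket x 0 = 0"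
  by (simp_all add: lie_bracket_def)

lemma pcomm_entry_add:
  assumes "1 \<le> i" "i \<le> n"
  shows "pcomm n (x(i := y + z)) = pcomm n (x(i := y)) + pcomm n (x(i := z))"
  using assms
proof (induction n)
  case (Suc n)
  show ?case
  proof (cases "i = Suc n")
    case True
    have "pcomm n (x(i := w)) = pcomm n x" for w
      using True by (intro pcomm_cong) auto
    then show ?thesis
      using True by (cases n)
        (simp_all del: fun_upd_apply add: fun_upd_same lie_bracket_def algebra_simps)
  next
    case False
    then have "i \<le> n" "n \<ge> 1" using Suc.prems by auto
    then show ?thesis
      using Suc.IH Suc.prems by (simp add: pcomm_Suc False lie_bracket_def algebra_simps)
  qed
qed simp

lemma pcomm_entry_diff:
  assumes "1 \<le> i" "i \<le> n"
  shows "pcomm n (x(i := y - z)) = pcomm n (x(i := y)) - pcomm n (x(i := z))"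
  using pcomm_entry_add[OF assms, of x "y - z" z] by simp

lemma lie_bracket_centre:
  "z \<in> centre \<Longrightarrow> lie_bracket z x = 0" "z \<in> centre \<Longrightarrow> lie_bracket x z = 0"
  by (simp_all add: centre_def lie_bracket_def)

lemma pcomm_entry_centre:
  assumes "n \<ge> 2" "1 \<le> i" "i \<le> n" "x i \<in> centre"
  shows "pcomm n x = 0"
  using assms
proof (induction n)
  case (Suc n)
  consider "i = Suc n" | "i \<le> n" "n \<ge> 2" | "n = 1" "i = 1"
    using Suc.prems by linarith
  then show ?case
    using Suc by cases (auto simp: pcomm_Suc lie_bracket_centre eval_nat_numeral)
qed simp

lemma pcomm_const_tail:
  "pcomm (Suc k) ((\<lambda>_. c)(1 := y)) = ((\<lambda>z. lie_bracket z c) ^^ k) y"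
  by (induction k) (auto simp: pcomm_Suc)

text \<open>
  This serves two purposes: a Lie n-derivation stays one when an inner derivation is subtracted, and
  the central part of a decomposition vanishes on iterated commutators.
\<close>

lemma additive_derivation_pcomm:
  fixes d :: "'a::ring_1 \<Rightarrow> 'a"
  assumes add: "\<And>x y. d (x + y) = d x + d y"
    and prod: "\<And>x y. d (x * y) = d x * y + x * d y"
  shows "d (pcomm n x) = (\<Sum>i=1..n. pcomm n (x(i := d (x i))))"
proof (induction n)
  case 0
  show ?case using add[of 0 0] by simp
next
  case (Suc n)
  have diff: "d (u - v) = d u - d v" for u v
    using add[of "u - v" v] by simp
  show ?case
  proof (cases "n = 0")
    case False
    have "(\<Sum>i=1..n. pcomm (Suc n) (x(i := d (x i))))
        = (\<Sum>i=1..n. lie_bracket (pcomm n (x(i := d (x i)))) (x (Suc n)))"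
      using False by (intro sum.cong) (simp_all add: pcomm_Suc)
    also have "\<dots> = lie_bracket (d (pcomm n x)) (x (Suc n))"
      by (simp del: fun_upd_apply
          add: Suc.IH lie_bracket_def sum_distrib_left sum_distrib_right sum_subtractf)
    finally have init: "(\<Sum>i=1..n. pcomm (Suc n) (x(i := d (x i))))
        = lie_bracket (d (pcomm n x)) (x (Suc n))" .
    have "pcomm n (x(Suc n := d (x (Suc n)))) = pcomm n x"
      by (intro pcomm_cong) auto
    with False have "pcomm (Suc n) (x(Suc n := d (x (Suc n))))
        = lie_bracket (pcomm n x) (d (x (Suc n)))"
      by (simp add: pcomm_Suc)
    with init have "(\<Sum>i=1..Suc n. pcomm (Suc n) (x(i := d (x i))))
        = lie_bracket (d (pcomm n x)) (x (Suc n)) + lie_bracket (pcomm n x) (d (x (Suc n)))"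
      by (simp del: fun_upd_apply)
    also have "\<dots> = d (lie_bracket (pcomm n x) (x (Suc n)))"
      by (simp add: lie_bracket_def diff prod algebra_simps)
    finally show ?thesis
      using False by (simp del: fun_upd_apply add: pcomm_Suc)
  qed simp
qed

section \<open>The Peirce decomposition of a faithful idempotent\<close>

abbreviation corner :: "'a::ring_1 \<Rightarrow> 'a \<Rightarrow> 'a set" where
  "corner u v \<equiv> sandwich u UNIV v"

lemma corner_mem: "u * x * v \<in> corner u v"
  by (simp add: sandwich_def)

lemma corner_iff:
  assumes "u * u = u" "v * v = v"
  shows "x \<in> corner u v \<longleftrightarrow> u * x = x \<and> x * v = x"
proof
  assume "x \<in> corner u v"
  then obtain y where "x = u * y * v" by (auto simp: sandwich_def)
  then show "u * x = x \<and> x * v = x"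
    using assms by (metis mult.assoc)
next
  assume "u * x = x \<and> x * v = x"
  then have "x = u * x * v" by simp
  then show "x \<in> corner u v" unfolding sandwich_def by blast
qed

text \<open>
  Both idempotents are parameters, with orthogonality as an assumption, so that the locale can be
  instantiated with \<open>e\<close> and \<open>f\<close> exchanged.
\<close>

locale faithful_idempotent =
  fixes e f :: "'a::ring_1"
  assumes ee: "e * e = e" and ff: "f * f = f" and ef: "e * f = 0" and fe: "f * e = 0"
    and e_plus_f: "e + f = 1"
    and faithful_e: "\<And>a. a \<in> corner e e \<Longrightarrow> (\<And>m. m \<in> corner e f \<Longrightarrow> a * m = 0) \<Longrightarrow>
          (\<And>t. t \<in> corner f e \<Longrightarrow> t * a = 0) \<Longrightarrow> a = 0"
    and faithful_f: "\<And>b. b \<in> corner f f \<Longrightarrow> (\<And>t. t \<in> corner f e \<Longrightarrow> b * t = 0) \<Longrightarrow>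
          (\<And>m. m \<in> corner e f \<Longrightarrow> m * b = 0) \<Longrightarrow> b = 0"
begin

lemma swap: "faithful_idempotent f e"
  using ee ff ef fe e_plus_f faithful_e faithful_f
  by unfold_locales (auto simp: add.commute)

lemma mem_ee: "x \<in> corner e e \<longleftrightarrow> e * x = x \<and> x * e = x"
  and mem_ef: "x \<in> corner e f \<longleftrightarrow> e * x = x \<and> x * f = x"
  and mem_fe: "x \<in> corner f e \<longleftrightarrow> f * x = x \<and> x * e = x"
  and mem_ff: "x \<in> corner f f \<longleftrightarrow> f * x = x \<and> x * f = x"
  by (simp_all add: corner_iff ee ff)

lemma right_e: "x * e = x \<Longrightarrow> x * f = 0"
  and right_f: "x * f = x \<Longrightarrow> x * e = 0"
  and left_e: "e * x = x \<Longrightarrow> f * x = 0"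
  and left_f: "f * x = x \<Longrightarrow> e * x = 0"
  by (metis ef mult.assoc mult_zero_right, metis fe mult.assoc mult_zero_right,
      metis fe mult.assoc mult_zero_left, metis ef mult.assoc mult_zero_left)

lemmas vanish = right_e right_f left_e left_f

lemma absorb:
  "e * (e * x) = e * x" "f * (f * x) = f * x" "e * (f * x) = 0" "f * (e * x) = 0"
  by (simp_all add: mult.assoc[symmetric] ee ff ef fe)

lemma split: "x = e * x * e + e * x * f + f * x * e + f * x * f"
proof -
  have "x = (e + f) * x * (e + f)" by (simp add: e_plus_f)
  then show ?thesis by (simp add: algebra_simps)
qed

lemma f_eq: "f = 1 - e"
  using e_plus_f by (simp add: algebra_simps)

lemma commute_e_f: "c * e = e * c \<longleftrightarrow> c * f = f * c"
  by (auto simp: f_eq algebra_simps)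

lemma centre_commutes: "z \<in> centre \<Longrightarrow> z * x = x * z"
  by (simp add: centre_def)

text \<open>
  The commutator \<open>[c, a]\<close> lies in \<open>eAe\<close> and annihilates both off-diagonal corners, because \<open>c\<close>
  commutes with \<open>m\<close> and \<open>am\<close>, and with \<open>t\<close> and \<open>ta\<close>; faithfulness then makes it zero.
\<close>

lemma commutes_corner_ee:
  assumes ce: "c * e = e * c"
    and cm: "\<And>m. m \<in> corner e f \<Longrightarrow> c * m = m * c"
    and ct: "\<And>t. t \<in> corner f e \<Longrightarrow> c * t = t * c"
    and a: "a \<in> corner e e"
  shows "c * a = a * c"
proof -
  have "c * a - a * c = 0"
  proof (rule faithful_e)
    show "c * a - a * c \<in> corner e e"
      using a ce unfolding mem_ee
      by (metis left_diff_distrib right_diff_distrib mult.assoc)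
  next
    fix m assume m: "m \<in> corner e f"
    then have "a * m \<in> corner e f"
      using a unfolding mem_ee mem_ef by (metis mult.assoc)
    then have "c * (a * m) = a * (m * c)"
      using cm by (simp add: mult.assoc)
    then show "(c * a - a * c) * m = 0"
      using cm[OF m] by (simp add: algebra_simps mult.assoc)
  next
    fix t assume t: "t \<in> corner f e"
    then have "t * a \<in> corner f e"
      using a unfolding mem_ee mem_fe by (metis mult.assoc)
    then have "t * (a * c) = c * (t * a)"
      using ct by (simp add: mult.assoc)
    then have "t * (a * c) = t * (c * a)"
      using ct[OF t] by (metis mult.assoc)
    then show "t * (c * a - a * c) = 0"
      by (simp add: algebra_simps)
  qed
  then show ?thesis by simp
qed

lemma centreI:
  assumes ce: "c * e = e * c"
    and cm: "\<And>m. m \<in> corner e f \<Longrightarrow> c * m = m * c"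
    and ct: "\<And>t. t \<in> corner f e \<Longrightarrow> c * t = t * c"
  shows "c \<in> centre"
proof -
  have "c * x = x * c" for x
  proof -
    have cf: "c * f = f * c" using ce commute_e_f by simp
    have "c * (e * x * e) = e * x * e * c"
      by (rule commutes_corner_ee[OF ce _ _ corner_mem]) (fact cm ct)+
    moreover have "c * (f * x * f) = f * x * f * c"
      by (rule faithful_idempotent.commutes_corner_ee[OF swap cf _ _ corner_mem]) (fact cm ct)+
    moreover have "c * (e * x * f) = e * x * f * c" by (rule cm[OF corner_mem])
    moreover have "c * (f * x * e) = f * x * e * c" by (rule ct[OF corner_mem])
    ultimately have "c * (e * x * e + e * x * f + f * x * e + f * x * f)
        = (e * x * e + e * x * f + f * x * e + f * x * f) * c"
      by (simp add: distrib_left distrib_right)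
    then show ?thesis by (simp only: split[of x, symmetric])
  qed
  then show ?thesis by (simp add: centre_def)
qed

text \<open>
  Applied to differences, this shows that one diagonal corner determines a central element. If
  \<open>fzf = 0\<close>, then \<open>z = ze\<close> lies in \<open>eAe\<close> and, being central, annihilates both off-diagonal corners.
\<close>

lemma centre_eq_0:
  assumes z: "z \<in> centre" and "f * z * f = 0"
  shows "z = 0"
proof -
  have "f * z * f = z * f"
    by (simp add: centre_commutes[OF z, of f, symmetric] mult.assoc ff)
  with assms have zf: "z * f = 0" by simp
  have "z * (e + f) = z" by (simp add: e_plus_f)
  then have ze: "z * e = z" by (simp add: distrib_left zf)
  show ?thesis
  proof (rule faithful_e)
    show "z \<in> corner e e"
      using ze centre_commutes[OF z, of e] by (simp add: mem_ee)
  next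
    fix m assume "m \<in> corner e f"
    moreover have "m * f * z = 0"
      using zf by (simp add: mult.assoc centre_commutes[OF z, of f, symmetric])
    ultimately show "z * m = 0"
      by (simp add: mem_ef centre_commutes[OF z, of m])
  next
    fix t assume "t \<in> corner f e"
    moreover have "z * f * t = 0" by (simp add: zf)
    ultimately show "t * z = 0"
      by (simp add: mem_fe mult.assoc centre_commutes[OF z, of t, symmetric])
  qed
qed

lemma power_bracket_ef:
  assumes "m \<in> corner e f"
  shows "((\<lambda>z. lie_bracket z f) ^^ k) m = m"
  using assms by (induction k) (auto simp: lie_bracket_def mem_ef vanish)

text \<open>
  Bracketing with \<open>f\<close> kills the diagonal, fixes \<open>eAf\<close> and negates \<open>fAe\<close>. Evenness of \<open>n\<close> enters
  through this lemma, at \<open>k = n - 1\<close>.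
\<close>

lemma power_bracket_odd:
  assumes "odd k"
  shows "((\<lambda>z. lie_bracket z f) ^^ k) y = lie_bracket y f"
proof -
  from assms obtain j where "k = Suc (2 * j)" by (auto elim: oddE)
  moreover have "((\<lambda>z. lie_bracket z f) ^^ Suc (2 * j)) y = lie_bracket y f"
    by (induction j) (simp_all add: lie_bracket_def algebra_simps ff absorb)
  ultimately show ?thesis by simp
qed

lemma pcomm_ef_const:
  assumes "m \<in> corner e f" "n \<ge> 1"
  shows "pcomm n ((\<lambda>_. f)(1 := m)) = m"
  using assms pcomm_const_tail[of "n - 1" f m] by (simp add: power_bracket_ef)

lemma bracket_ef_diagonal:
  assumes m: "m \<in> corner e f" and c: "c * e = e * c"
  shows "lie_bracket m c \<in> corner e f"
proof -
  have "c * f = f * c" using c commute_e_f by simp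
  then show ?thesis
    using m c unfolding lie_bracket_def mem_ef
    by (metis mult.assoc right_diff_distrib left_diff_distrib)
qed

text \<open>
  A diagonal entry \<open>c\<close> may sit in any later position: the entries \<open>f\<close> before it fix \<open>m\<close>, and those
  after it fix \<open>[m, c]\<close>, which is still in \<open>eAf\<close>. These terms produce the factor \<open>n - 1\<close>.
\<close>

lemma pcomm_ef_diagonal_entry:
  assumes m: "m \<in> corner e f" and c: "c * e = e * c" and "2 \<le> i" "i \<le> n"
  shows "pcomm n ((\<lambda>_. f)(1 := m, i := c)) = lie_bracket m c"
  using assms(3,4)
proof (induction n)
  case (Suc n)
  show ?case
  proof (cases "i = Suc n")
    case True
    have "pcomm n ((\<lambda>_. f)(1 := m, i := c)) = pcomm n ((\<lambda>_. f)(1 := m))"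
      using True by (intro pcomm_cong) auto
    also have "\<dots> = m"
      using True Suc.prems m by (intro pcomm_ef_const) auto
    finally show ?thesis
      using True Suc.prems by (simp del: fun_upd_apply One_nat_def add: pcomm_Suc fun_upd_same)
  next
    case False
    have "lie_bracket (lie_bracket m c) f = lie_bracket m c"
      using bracket_ef_diagonal[OF m c] left_e
      by (simp add: lie_bracket_def[of "lie_bracket m c"] mem_ef)
    then show ?thesis
      using False Suc by (simp add: pcomm_Suc)
  qed
qed simp

lemma pcomm_ef_last:
  assumes m: "m \<in> corner e f" and "n \<ge> 2"
  shows "pcomm n ((\<lambda>_. f)(1 := m, n := y)) = lie_bracket m y"
proof -
  obtain k where k: "n = Suc k" "k \<ge> 1" using assms by (cases n) auto
  have "pcomm k ((\<lambda>_. f)(1 := m, n := y)) = pcomm k ((\<lambda>_. f)(1 := m))"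
    using k by (intro pcomm_cong) auto
  also have "\<dots> = m" using k m by (intro pcomm_ef_const) auto
  finally show ?thesis
    using k by (simp del: fun_upd_apply One_nat_def add: pcomm_Suc fun_upd_same)
qed

end

section \<open>Lie n-derivations with diagonal value at the idempotent\<close>

text \<open>
  Diagonality of \<open>\<phi>(e)\<close> is the normalisation that an inner derivation can always achieve.
\<close>

locale diagonal_lie_n_derivation = faithful_idempotent e f for e f :: "'a::ring_1" +
  fixes n :: nat and \<phi> :: "'a \<Rightarrow> 'a"
  assumes n2: "n \<ge> 2" and even_n: "even n"
    and torsion2: "torsion_free 2 TYPE('a)" and torsion_n: "torsion_free (n - 1) TYPE('a)"
    and add: "\<And>x y. \<phi> (x + y) = \<phi> x + \<phi> y"
    and lie: "\<And>x. \<phi> (pcomm n x) = (\<Sum>i=1..n. pcomm n (x(i := \<phi> (x i))))"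
    and phi_e: "\<phi> e * e = e * \<phi> e"
begin

lemma phi_0: "\<phi> 0 = 0"
  using add[of 0 0] by simp

lemma phi_diff: "\<phi> (x - y) = \<phi> x - \<phi> y"
  using add[of "x - y" y] by simp

lemma lie_single:
  assumes "j \<in> {1..n}" "\<And>i. i \<in> {1..n} - {j} \<Longrightarrow> pcomm n (x(i := \<phi> (x i))) = 0"
  shows "\<phi> (pcomm n x) = pcomm n (x(j := \<phi> (x j)))"
proof -
  let ?p = "\<lambda>i. pcomm n (x(i := \<phi> (x i)))"
  have "\<phi> (pcomm n x) = sum ?p {1..n}" by (rule lie)
  also have "\<dots> = ?p j + sum ?p ({1..n} - {j})"
    by (rule sum.remove[OF finite_atLeastAtMost assms(1)])
  also have "sum ?p ({1..n} - {j}) = 0" by (intro sum.neutral ballI assms(2))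
  finally show ?thesis by (simp del: fun_upd_apply)
qed

lemma pcomm_const: "pcomm n ((\<lambda>_. f)(1 := y)) = lie_bracket y f"
  using n2 even_n pcomm_const_tail[of "n - 1" f y] by (simp add: power_bracket_odd)

lemma one_central: "(1::'a) \<in> centre"
  by (simp add: centre_def)

text \<open>
  Needed for the symmetry: it transfers diagonality from \<open>\<phi>(e)\<close> to \<open>\<phi>(f) = \<phi>(1) - \<phi>(e)\<close>. Apply the
  Lie identity to \<open>p\<^sub>n(1, f, \<dots>, f) = 0\<close>; every term that keeps the central entry \<open>1\<close> vanishes.
\<close>

lemma phi_one_diagonal: "\<phi> 1 * f = f * \<phi> 1"
proof -
  let ?x = "(\<lambda>_. f)(1::nat := 1)"
  have "\<phi> (pcomm n ?x) = pcomm n (?x(1 := \<phi> (?x 1)))"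
  proof (rule lie_single)
    show "pcomm n (?x(i := \<phi> (?x i))) = 0" if "i \<in> {1..n} - {1}" for i
      using that n2 one_central by (intro pcomm_entry_centre[of n 1]) auto
  qed (use n2 in simp)
  then have "\<phi> (lie_bracket 1 f) = lie_bracket (\<phi> 1) f"
    by (simp only: fun_upd_upd fun_upd_same pcomm_const)
  then show ?thesis by (simp add: lie_bracket_def phi_0)
qed

lemma phi_f_eq: "\<phi> f = \<phi> 1 - \<phi> e"
  by (simp add: f_eq phi_diff)

lemma phi_f: "\<phi> f * f = f * \<phi> f"
  unfolding phi_f_eq left_diff_distrib right_diff_distrib
  using phi_one_diagonal phi_e[unfolded commute_e_f] by simp

lemma swap: "diagonal_lie_n_derivation f e n \<phi>"
  by (rule diagonal_lie_n_derivation.intro[OF faithful_idempotent.swap[OF faithful_idempotent_axioms]],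
      rule diagonal_lie_n_derivation_axioms.intro)
    (rule n2 even_n torsion2 torsion_n add lie phi_f)+

lemma double_eq_0: "y + y = 0 \<Longrightarrow> y = 0" for y :: 'a
  using torsion2 unfolding torsion_free_def of_nat_numeral mult_2 by blast

text \<open>
  The Lie identity at \<open>p\<^sub>n(m, f, \<dots>, f) = m\<close> reads \<open>\<phi>(m) = [\<phi>(m), f] + (n - 1)[m, \<phi>(f)]\<close>. The
  diagonal corners of the right-hand side are zero, its \<open>fAe\<close> part is the negative of that of
  \<open>\<phi>(m)\<close>, and its \<open>eAf\<close> part exceeds that of \<open>\<phi>(m)\<close> by \<open>(n - 1)[m, \<phi>(f)]\<close>.
\<close>

lemma phi_ef_and_bracket:
  assumes m: "m \<in> corner e f"
  shows "\<phi> m \<in> corner e f" and "lie_bracket m (\<phi> f) = 0"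
proof -
  let ?x = "(\<lambda>_. f)(1::nat := m)"
  define k where "k = of_nat (n - 1) * lie_bracket m (\<phi> f)"
  have c: "\<phi> f * e = e * \<phi> f" using phi_f commute_e_f by simp
  have "pcomm n (?x(i := \<phi> (?x i))) = lie_bracket m (\<phi> f)" if "i \<in> {2..n}" for i
    using that m c pcomm_ef_diagonal_entry[of m "\<phi> f" i n] by auto
  then have "(\<Sum>i=2..n. pcomm n (?x(i := \<phi> (?x i)))) = (\<Sum>i=2..n. lie_bracket m (\<phi> f))"
    by (intro sum.cong) blast+
  also have "\<dots> = k"
    using n2 by (simp add: k_def)
  finally have "(\<Sum>i=2..n. pcomm n (?x(i := \<phi> (?x i)))) = k" .
  moreover have "\<phi> (pcomm n ?x)
      = pcomm n (?x(1 := \<phi> (?x 1))) + (\<Sum>i=2..n. pcomm n (?x(i := \<phi> (?x i))))"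
    unfolding lie using n2
    by (subst sum.atLeast_Suc_atMost) (simp_all del: One_nat_def fun_upd_apply add: Suc_1)
  ultimately have "\<phi> (pcomm n ?x) = pcomm n (?x(1 := \<phi> (?x 1))) + k"
    by (simp only:)
  moreover have "pcomm n ?x = m"
    using m n2 by (intro pcomm_ef_const) auto
  ultimately have eq: "\<phi> m = \<phi> m * f - f * \<phi> m + k"
    by (simp only: fun_upd_upd fun_upd_same pcomm_const lie_bracket_def)
  have bm: "e * lie_bracket m (\<phi> f) = lie_bracket m (\<phi> f)"
    "lie_bracket m (\<phi> f) * f = lie_bracket m (\<phi> f)"
    using bracket_ef_diagonal[OF m c] unfolding mem_ef by blast+
  have "e * k = of_nat (n - 1) * (e * lie_bracket m (\<phi> f))"
    unfolding k_def by (simp only: mult.assoc[symmetric] mult_of_nat_commute[of "n - 1" e])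
  then have ek: "e * k = k" "k * f = k"
    using bm by (simp_all only: k_def mult.assoc)
  have part: "u * \<phi> m * v = u * (\<phi> m * f - f * \<phi> m + k) * v" for u v
    using eq by (rule arg_cong)
  have "e * (\<phi> m * f - f * \<phi> m + k) * e = 0" "f * (\<phi> m * f - f * \<phi> m + k) * f = 0"
    "f * (\<phi> m * f - f * \<phi> m + k) * e = - (f * \<phi> m * e)"
    "e * (\<phi> m * f - f * \<phi> m + k) * f = e * \<phi> m * f + k"
    using ek left_e[OF ek(1)] right_f[OF ek(2)] by (simp_all add: algebra_simps ee ff ef fe absorb)
  note parts = this[unfolded part[symmetric]]
  have k0: "k = 0" using parts(4) by simp
  have "f * \<phi> m * e + f * \<phi> m * e = 0" using parts(3) by (metis add.right_inverse)
  then have "f * \<phi> m * e = 0" by (rule double_eq_0)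
  with parts(1,2) have "e * \<phi> m * f = \<phi> m"
    by (subst (2) split[of "\<phi> m"]) simp
  then show "\<phi> m \<in> corner e f" unfolding sandwich_def by (metis UNIV_I imageI)
  show "lie_bracket m (\<phi> f) = 0"
    using k0 torsion_n by (simp add: k_def torsion_free_def)
qed

text \<open>
  The mirror image of the previous lemma says that \<open>\<phi>(e)\<close>, rather than \<open>\<phi>(f)\<close>, commutes with
  \<open>fAe\<close>. The present fact bridges the two.
\<close>

lemma bracket_phi_one:
  assumes m: "m \<in> corner e f"
  shows "lie_bracket m (\<phi> 1) = 0"
proof -
  let ?x = "(\<lambda>_. f)(1::nat := m, n := 1)"
  have "\<phi> (pcomm n ?x) = pcomm n (?x(n := \<phi> (?x n)))"
  proof (rule lie_single)
    show "pcomm n (?x(i := \<phi> (?x i))) = 0" if "i \<in> {1..n} - {n}" for i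
      using that n2 one_central by (intro pcomm_entry_centre[of n n]) auto
  qed (use n2 in simp)
  then have "\<phi> (lie_bracket m 1) = lie_bracket m (\<phi> 1)"
    using m n2 by (simp only: fun_upd_upd fun_upd_same pcomm_ef_last)
  then show ?thesis by (simp add: phi_0 lie_bracket_def)
qed

lemma phi_f_centre: "\<phi> f \<in> centre"
proof (rule centreI)
  show "\<phi> f * e = e * \<phi> f" using phi_f commute_e_f by simp
  show "\<phi> f * m = m * \<phi> f" if "m \<in> corner e f" for m
    using phi_ef_and_bracket(2)[OF that] by (simp add: lie_bracket_def)
  show "\<phi> f * t = t * \<phi> f" if "t \<in> corner f e" for t
  proof -
    have "t * \<phi> e = \<phi> e * t" "t * \<phi> 1 = \<phi> 1 * t"
      using diagonal_lie_n_derivation.phi_ef_and_bracket(2)[OF swap that]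
        diagonal_lie_n_derivation.bracket_phi_one[OF swap that]
      by (simp_all add: lie_bracket_def)
    then show ?thesis
      unfolding phi_f_eq left_diff_distrib right_diff_distrib by simp
  qed
qed

text \<open>
  Here \<open>p\<^sub>n(x, f, \<dots>, f) = 0\<close>, and since \<open>\<phi>(f)\<close> is central only the first term of the Lie identity
  survives.
\<close>

lemma phi_diagonal:
  assumes "x * f = f * x"
  shows "\<phi> x * f = f * \<phi> x"
proof -
  let ?x = "(\<lambda>_. f)(1::nat := x)"
  have "\<phi> (pcomm n ?x) = pcomm n (?x(1 := \<phi> (?x 1)))"
  proof (rule lie_single)
    show "pcomm n (?x(i := \<phi> (?x i))) = 0" if "i \<in> {1..n} - {1}" for i
      using that n2 phi_f_centre by (intro pcomm_entry_centre[of n i]) auto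
  qed (use n2 in simp)
  then have "\<phi> (lie_bracket x f) = lie_bracket (\<phi> x) f"
    by (simp only: fun_upd_upd fun_upd_same pcomm_const)
  then show ?thesis using assms by (simp add: lie_bracket_def phi_0)
qed

end

section \<open>Splitting off the central part\<close>

text \<open>
  Used when \<open>uyu\<close> is the \<open>u\<close>-corner of a central element. It depends on a single idempotent, so
  exchanging \<open>e\<close> and \<open>f\<close> needs no second definition.
\<close>

definition central_lift :: "'a::ring_1 \<Rightarrow> 'a \<Rightarrow> 'a" where
  "central_lift u y = (THE z. z \<in> centre \<and> u * z * u = u * y * u)"

lemma centre_add: "z \<in> centre \<Longrightarrow> w \<in> centre \<Longrightarrow> z + w \<in> centre"
  and centre_diff: "z \<in> centre \<Longrightarrow> w \<in> centre \<Longrightarrow> z - w \<in> centre"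
  by (simp_all add: centre_def distrib_left distrib_right left_diff_distrib right_diff_distrib)

context faithful_idempotent
begin

lemma central_lift_eqI:
  assumes "z \<in> centre" "f * z * f = f * y * f"
  shows "central_lift f y = z"
  unfolding central_lift_def
proof (rule the_equality)
  fix w assume w: "w \<in> centre \<and> f * w * f = f * y * f"
  have "w - z = 0"
    by (rule centre_eq_0) (use w assms in \<open>simp_all add: centre_diff left_diff_distrib right_diff_distrib\<close>)
  then show "w = z" by simp
qed (use assms in simp)

lemma central_lift:
  assumes "f * y * f \<in> sandwich f centre f"
  shows "central_lift f y \<in> centre" "f * central_lift f y * f = f * y * f"
proof -
  from assms obtain z where z: "f * y * f = f * z * f" "z \<in> centre"
    unfolding sandwich_def by (rule imageE)
  have "central_lift f y = z" by (rule central_lift_eqI[OF z(2) z(1)[symmetric]])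
  then show "central_lift f y \<in> centre" "f * central_lift f y * f = f * y * f"
    using z by simp_all
qed

lemma central_lift_add:
  assumes "f * x * f \<in> sandwich f centre f" "f * y * f \<in> sandwich f centre f"
  shows "central_lift f (x + y) = central_lift f x + central_lift f y"
  using central_lift[OF assms(1)] central_lift[OF assms(2)]
  by (intro central_lift_eqI centre_add) (simp_all add: distrib_left distrib_right)

end

text \<open>
  The two conditions of the characterisation, for a normalised \<open>\<phi>\<close>.
\<close>

locale proper_lie_n_derivation = diagonal_lie_n_derivation +
  assumes phi_ee: "a \<in> corner e e \<Longrightarrow> f * \<phi> a * f \<in> sandwich f centre f"
    and phi_ff: "b \<in> corner f f \<Longrightarrow> e * \<phi> b * e \<in> sandwich e centre e"
    and phi_cross: "m \<in> corner e f \<Longrightarrow> t \<in> corner f e \<Longrightarrow>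
          e * \<phi> (t * m) * e + f * \<phi> (m * t) * f \<in> centre"
begin

text \<open>
  Each diagonal corner of \<open>x\<close> contributes the central element that \<open>\<phi>\<close> leaks into the opposite
  corner. The name \<open>der\<close> anticipates that the remainder is a derivation.
\<close>

definition tau :: "'a \<Rightarrow> 'a" where
  "tau x = central_lift f (\<phi> (e * x * e)) + central_lift e (\<phi> (f * x * f))"

definition der :: "'a \<Rightarrow> 'a" where
  "der x = \<phi> x - tau x"

lemma proper_swap: "proper_lie_n_derivation f e n \<phi>"
proof (rule proper_lie_n_derivation.intro[OF swap], rule proper_lie_n_derivation_axioms.intro)
  show "f * \<phi> (m * t) * f + e * \<phi> (t * m) * e \<in> centre"
    if "t \<in> corner f e" "m \<in> corner e f" for m t
    using phi_cross[OF that(2,1)] by (simp only: add.commute)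
qed (fact phi_ff phi_ee)+

lemma tau_swap: "proper_lie_n_derivation.tau f e \<phi> = tau"
  by (rule ext) (simp add: tau_def proper_lie_n_derivation.tau_def[OF proper_swap] add.commute)

lemma der_swap: "proper_lie_n_derivation.der f e \<phi> = der"
  by (rule ext)
    (simp add: der_def proper_lie_n_derivation.der_def[OF proper_swap] tau_swap)

lemma lift_ee:
  "central_lift f (\<phi> (e * x * e)) \<in> centre"
  "f * central_lift f (\<phi> (e * x * e)) * f = f * \<phi> (e * x * e) * f"
  by (rule central_lift[OF phi_ee[OF corner_mem]])+

lemma lift_ff: "central_lift e (\<phi> (f * x * f)) \<in> centre"
  using proper_lie_n_derivation.lift_ee(1)[OF proper_swap] .

lemma tau_centre: "tau x \<in> centre"
  unfolding tau_def by (intro centre_add lift_ee lift_ff)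

lemma lift_ee_add: "central_lift f (\<phi> (e * (x + y) * e))
    = central_lift f (\<phi> (e * x * e)) + central_lift f (\<phi> (e * y * e))"
proof -
  have "f * \<phi> (e * w * e) * f \<in> sandwich f centre f" for w
    by (rule phi_ee[OF corner_mem])
  then show ?thesis
    by (simp add: distrib_left distrib_right add central_lift_add)
qed

lemma tau_add: "tau (x + y) = tau x + tau y"
  using proper_lie_n_derivation.lift_ee_add[OF proper_swap, of x y]
  unfolding tau_def by (simp add: lift_ee_add)

lemma der_add: "der (x + y) = der x + der y"
  by (simp add: der_def add tau_add)

lemma der_0: "der 0 = 0"
  using der_add[of 0 0] by simp

lemma lift_0: "central_lift f 0 = 0"
  by (intro central_lift_eqI) (simp_all add: centre_def)

lemma tau_ee: "a \<in> corner e e \<Longrightarrow> tau a = central_lift f (\<phi> a)"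
  using diagonal_lie_n_derivation.phi_0[OF swap] proper_lie_n_derivation.lift_0[OF proper_swap]
  by (auto simp: mem_ee tau_def vanish)

lemma tau_ff: "b \<in> corner f f \<Longrightarrow> tau b = central_lift e (\<phi> b)"
  using proper_lie_n_derivation.tau_ee[OF proper_swap] by (simp add: tau_swap)

lemma tau_ef: "m \<in> corner e f \<Longrightarrow> tau m = 0"
  using phi_0 lift_0 proper_lie_n_derivation.lift_0[OF proper_swap]
  by (simp add: mem_ef tau_def vanish)

lemma der_ee:
  assumes a: "a \<in> corner e e"
  shows "der a \<in> corner e e"
proof -
  have "a * f = f * a" using a by (simp add: mem_ee vanish)
  then have "der a * f = f * der a"
    using phi_diagonal[of a] centre_commutes[OF tau_centre]
    by (simp add: der_def left_diff_distrib right_diff_distrib)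
  moreover have "f * der a * f = 0"
    using central_lift(2)[OF phi_ee[OF a]] tau_ee[OF a]
    by (simp add: der_def left_diff_distrib right_diff_distrib)
  ultimately have "der a * f = 0" "f * der a = 0"
    by (metis ff mult.assoc)+
  then show ?thesis
    by (simp add: mem_ee f_eq algebra_simps)
qed

lemma der_ff: "b \<in> corner f f \<Longrightarrow> der b \<in> corner f f"
  using proper_lie_n_derivation.der_ee[OF proper_swap] by (simp add: der_swap)

lemma der_eq_phi: "m \<in> corner e f \<Longrightarrow> der m = \<phi> m"
  by (simp add: der_def tau_ef)

lemma der_ef: "m \<in> corner e f \<Longrightarrow> der m \<in> corner e f"
  by (simp add: der_eq_phi phi_ef_and_bracket)

lemma der_fe: "t \<in> corner f e \<Longrightarrow> der t \<in> corner f e"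
  using proper_lie_n_derivation.der_ef[OF proper_swap] by (simp add: der_swap)

text \<open>
  As \<open>\<phi>(f)\<close> is central, so is \<open>h(f)\<close>; but \<open>h(f)\<close> also lies in \<open>fAf\<close>, so its \<open>e\<close>-corner vanishes.
\<close>

lemma der_f: "der f = 0"
proof -
  have "der f \<in> corner f f" by (intro der_ff) (simp add: mem_ff ff)
  then have "e * der f * e = 0" by (simp add: mem_ff vanish)
  moreover have "der f \<in> centre"
    unfolding der_def by (intro centre_diff phi_f_centre tau_centre)
  ultimately show ?thesis
    using faithful_idempotent.centre_eq_0[OF faithful_idempotent.swap[OF faithful_idempotent_axioms]]
    by blast
qed

lemma lie_der: "\<phi> (pcomm n x) = (\<Sum>i=1..n. pcomm n (x(i := der (x i))))"
proof -
  have "pcomm n (x(i := tau (x i))) = 0" if "i \<in> {1..n}" for i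
    using that n2 tau_centre by (intro pcomm_entry_centre[of n i]) auto
  then have "pcomm n (x(i := der (x i))) = pcomm n (x(i := \<phi> (x i)))" if "i \<in> {1..n}" for i
    using that by (simp del: fun_upd_apply add: der_def pcomm_entry_diff)
  then show ?thesis by (simp only: lie cong: sum.cong)
qed

text \<open>
  In the Lie identity at \<open>p\<^sub>n(m, f, \<dots>, f, y) = [m, y]\<close> only the outer two terms survive, as \<open>h(f) = 0\<close>.
  With \<open>y\<close> in \<open>eAe\<close>, \<open>fAf\<close> and \<open>fAe\<close> this yields all product rules that involve \<open>eAf\<close>.
\<close>

lemma phi_bracket_ef:
  assumes m: "m \<in> corner e f"
  shows "\<phi> (lie_bracket m y) = lie_bracket (der m) y + lie_bracket m (der y)"
proof -
  let ?x = "(\<lambda>_. f)(1::nat := m, n := y)"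
  let ?p = "\<lambda>i. pcomm n (?x(i := der (?x i)))"
  have zero: "pcomm n (?x(i := der (?x i))) = 0" if "i \<in> {1..n} - {n} - {1}" for i
    using that n2 by (intro pcomm_entry_centre[of n i]) (auto simp: der_f centre_def)
  have "n \<noteq> 1" using n2 by simp
  have "\<phi> (pcomm n ?x) = ?p n + (?p 1 + (\<Sum>i \<in> {1..n} - {n} - {1}. ?p i))"
    unfolding lie_der using n2
    by (subst sum.remove[of _ n], simp, simp, subst sum.remove[of _ 1]) auto
  also have "(\<Sum>i \<in> {1..n} - {n} - {1}. ?p i) = 0"
    by (intro sum.neutral ballI zero)
  finally have "\<phi> (pcomm n ?x) = ?p n + ?p 1" by (simp only: add_0_right)
  moreover have "?x(1 := der (?x 1)) = (\<lambda>_. f)(1 := der m, n := y)"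
    "?x(n := der (?x n)) = (\<lambda>_. f)(1 := m, n := der y)"
    using \<open>n \<noteq> 1\<close> by (simp_all add: fun_eq_iff)
  ultimately show ?thesis
    by (simp only: pcomm_ef_last[OF m n2] pcomm_ef_last[OF der_ef[OF m] n2] add.commute)
qed

lemma der_prod_ee_ef:
  assumes a: "a \<in> corner e e" and m: "m \<in> corner e f"
  shows "der (a * m) = der a * m + a * der m"
proof -
  have "a * m \<in> corner e f" using a m unfolding mem_ee mem_ef by (metis mult.assoc)
  then have "der (a * m) = \<phi> (a * m)" by (rule der_eq_phi)
  moreover have "m * a = 0" "m * der a = 0" "der m * a = 0"
    using a der_ee[OF a] m der_ef[OF m] unfolding mem_ee mem_ef
    by (metis mult.assoc fe mult_zero_left mult_zero_right)+
  moreover have "\<phi> (0 - a * m) = 0 - \<phi> (a * m)" by (simp only: phi_diff phi_0)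
  ultimately show ?thesis
    using phi_bracket_ef[OF m, of a] by (simp add: lie_bracket_def algebra_simps)
qed

lemma der_prod_ef_ff:
  assumes m: "m \<in> corner e f" and b: "b \<in> corner f f"
  shows "der (m * b) = der m * b + m * der b"
proof -
  have "m * b \<in> corner e f" using b m unfolding mem_ff mem_ef by (metis mult.assoc)
  then have "der (m * b) = \<phi> (m * b)" by (rule der_eq_phi)
  moreover have "b * m = 0" "der b * m = 0" "b * der m = 0"
    using b der_ff[OF b] m der_ef[OF m] unfolding mem_ff mem_ef
    by (metis mult.assoc fe mult_zero_left mult_zero_right)+
  ultimately show ?thesis
    using phi_bracket_ef[OF m, of b] by (simp add: lie_bracket_def)
qed

lemma der_prod_fe_ee:
  assumes "t \<in> corner f e" "a \<in> corner e e"
  shows "der (t * a) = der t * a + t * der a"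
  using proper_lie_n_derivation.der_prod_ef_ff[OF proper_swap assms] by (simp add: der_swap)

lemma der_prod_ff_fe:
  assumes "b \<in> corner f f" "t \<in> corner f e"
  shows "der (b * t) = der b * t + b * der t"
  using proper_lie_n_derivation.der_prod_ee_ef[OF proper_swap assms] by (simp add: der_swap)

text \<open>
  Expand \<open>h(acm)\<close> as \<open>h((ac)m)\<close> and as \<open>h(a(cm))\<close>, and \<open>h(tac)\<close> likewise: the defect of the product
  rule for \<open>a\<close> and \<open>c\<close> annihilates both off-diagonal corners.
\<close>

lemma der_prod_ee_ee:
  assumes a: "a \<in> corner e e" and c: "c \<in> corner e e"
  shows "der (a * c) = der a * c + a * der c"
proof -
  let ?d = "der (a * c) - (der a * c + a * der c)"
  have ac: "a * c \<in> corner e e" using a c unfolding mem_ee by (metis mult.assoc)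
  have "?d = 0"
  proof (rule faithful_e)
    have "der a * c \<in> corner e e" "a * der c \<in> corner e e"
      using a c der_ee unfolding mem_ee by (metis mult.assoc)+
    with der_ee[OF ac] show "?d \<in> corner e e"
      by (simp add: mem_ee algebra_simps)
  next
    fix m assume m: "m \<in> corner e f"
    then have cm: "c * m \<in> corner e f" using c unfolding mem_ee mem_ef by (metis mult.assoc)
    have "der (a * c) * m + a * c * der m = der a * (c * m) + a * (der c * m + c * der m)"
      using der_prod_ee_ef[OF ac m] der_prod_ee_ef[OF a cm] der_prod_ee_ef[OF c m]
      by (simp add: mult.assoc)
    then show "?d * m = 0" by (simp add: algebra_simps)
  next
    fix t assume t: "t \<in> corner f e"
    then have ta: "t * a \<in> corner f e" using a unfolding mem_ee mem_fe by (metis mult.assoc)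
    have "der t * (a * c) + t * der (a * c) = (der t * a + t * der a) * c + t * a * der c"
      using der_prod_fe_ee[OF t ac] der_prod_fe_ee[OF ta c] der_prod_fe_ee[OF t a]
      by (simp add: mult.assoc)
    then show "t * ?d = 0" by (simp add: algebra_simps)
  qed
  then show ?thesis by simp
qed

text \<open>
  With \<open>z = \<tau>(mt)\<close> and \<open>w = \<tau>(tm)\<close>, the second condition says that \<open>ew + fz\<close> is central. Commuting it
  with \<open>u\<close> in \<open>fAe\<close> gives \<open>zu = wu\<close>, and with \<open>v\<close> in \<open>eAf\<close> gives \<open>vw = vz\<close>, so faithfulness makes
  the \<open>f\<close>-corner of the central element \<open>z - w\<close> vanish.
\<close>

lemma tau_cross:
  assumes m: "m \<in> corner e f" and t: "t \<in> corner f e"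
  shows "tau (m * t) = tau (t * m)"
proof -
  have mt: "m * t \<in> corner e e" and tm: "t * m \<in> corner f f"
    using m t unfolding mem_ee mem_ff mem_ef mem_fe by (metis mult.assoc)+
  define z w where "z = tau (m * t)" and "w = tau (t * m)"
  have zc: "z \<in> centre" and wc: "w \<in> centre" by (simp_all add: z_def w_def tau_centre)
  have "f * z * f = f * \<phi> (m * t) * f"
    unfolding z_def tau_ee[OF mt] by (rule central_lift(2)[OF phi_ee[OF mt]])
  moreover have "e * w * e = e * \<phi> (t * m) * e"
    unfolding w_def tau_ff[OF tm]
    by (rule faithful_idempotent.central_lift(2)
        [OF faithful_idempotent.swap[OF faithful_idempotent_axioms] phi_ff[OF tm]])
  ultimately have "e * w * e + f * z * f \<in> centre" using phi_cross[OF m t] by simp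
  moreover have "e * w * e = e * w" "f * z * f = f * z"
    by (simp_all add: mult.assoc centre_commutes[OF wc, of e] centre_commutes[OF zc, of f] absorb)
  ultimately have c: "e * w + f * z \<in> centre" by simp
  have "z - w = 0"
  proof (rule centre_eq_0)
    show "z - w \<in> centre" by (intro centre_diff zc wc)
    show "f * (z - w) * f = 0"
    proof (rule faithful_f)
      show "f * (z - w) * f \<in> corner f f" by (simp add: sandwich_def)
    next
      fix u assume "u \<in> corner f e"
      then have fu: "f * u = u" "u * e = u" by (simp_all add: mem_fe)
      have "(e * w + f * z) * u = e * u * w + f * u * z"
        by (simp add: distrib_right mult.assoc centre_commutes[OF wc, of u] centre_commutes[OF zc, of u])
      also have "\<dots> = z * u"
        by (simp add: fu left_f[OF fu(1)] centre_commutes[OF zc, of u])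
      finally have "z * u = (e * w + f * z) * u" ..
      also have "\<dots> = u * e * w + u * f * z"
        by (simp add: centre_commutes[OF c, of u] distrib_left mult.assoc)
      also have "\<dots> = w * u"
        by (simp add: fu right_e[OF fu(2)] centre_commutes[OF wc, of u])
      finally have "(z - w) * u = 0" by (simp add: left_diff_distrib)
      then show "f * (z - w) * f * u = 0" by (simp add: mult.assoc fu)
    next
      fix v assume "v \<in> corner e f"
      then have ev: "e * v = v" "v * f = v" by (simp_all add: mem_ef)
      have "(e * w + f * z) * v = e * v * w + f * v * z"
        by (simp add: distrib_right mult.assoc centre_commutes[OF wc, of v] centre_commutes[OF zc, of v])
      also have "\<dots> = v * w" by (simp add: ev left_e[OF ev(1)])
      finally have "v * w = (e * w + f * z) * v" ..
      also have "\<dots> = v * e * w + v * f * z"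
        by (simp add: centre_commutes[OF c, of v] distrib_left mult.assoc)
      also have "\<dots> = v * z" by (simp add: ev right_f[OF ev(2)])
      finally have "v * (z - w) = 0" by (simp add: right_diff_distrib)
      then show "v * (f * (z - w) * f) = 0" by (simp add: mult.assoc[symmetric] ev)
    qed
  qed
  then show ?thesis by (simp add: z_def w_def)
qed

text \<open>
  Multiplying \<open>h(mt) - h(tm) = [h(m), t] + [m, h(t)]\<close> by \<open>e\<close> on the left isolates the products in \<open>eAe\<close>.
\<close>

lemma der_prod_ef_fe:
  assumes m: "m \<in> corner e f" and t: "t \<in> corner f e"
  shows "der (m * t) = der m * t + m * der t"
proof -
  have mt: "m * t \<in> corner e e" and tm: "t * m \<in> corner f f"
    using m t unfolding mem_ee mem_ff mem_ef mem_fe by (metis mult.assoc)+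
  have "der (m * t) - der (t * m) = \<phi> (lie_bracket m t)"
    using tau_cross[OF m t] by (simp add: der_def lie_bracket_def phi_diff)
  then have "e * (der (m * t) - der (t * m))
      = e * (lie_bracket (der m) t + lie_bracket m (der t))"
    using phi_bracket_ef[OF m, of t] by simp
  moreover have "e * (der m * t) = der m * t" "e * (m * der t) = m * der t"
    "e * (t * der m) = 0" "e * (der t * m) = 0"
    using m t der_ef[OF m] der_fe[OF t] unfolding mem_ef mem_fe
    by (metis mult.assoc ef mult_zero_left)+
  ultimately show ?thesis
    using der_ee[OF mt] der_ff[OF tm]
    by (simp add: mem_ee mem_ff vanish lie_bracket_def right_diff_distrib distrib_left)
qed

lemma der_mem:
  assumes "{u, v} \<subseteq> {e, f}" "x \<in> corner u v"
  shows "der x \<in> corner u v"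
  using assms der_ee der_ef der_fe der_ff by auto

lemma der_prod_corner:
  assumes "u \<in> {e, f}" "v \<in> {e, f}" "w \<in> {e, f}" "x \<in> corner u v" "y \<in> corner v w"
  shows "der (x * y) = der x * y + x * der y"
proof -
  have "der (x * y) = der x * y + x * der y" if "u = e"
    using assms that der_prod_ee_ee der_prod_ee_ef der_prod_ef_fe der_prod_ef_ff by auto
  moreover have "der (x * y) = der x * y + x * der y" if "u = f"
    using assms that der_prod_fe_ee der_prod_ff_fe
      proper_lie_n_derivation.der_prod_ee_ee[OF proper_swap]
      proper_lie_n_derivation.der_prod_ef_fe[OF proper_swap]
    unfolding der_swap by auto
  ultimately show ?thesis using assms(1) by blast
qed

lemma der_prod_corner_mismatch:
  assumes "{u, v, v', w} \<subseteq> {e, f}" "v \<noteq> v'" "x \<in> corner u v" "y \<in> corner v' w"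
  shows "der (x * y) = der x * y + x * der y"
proof -
  have idem: "u * u = u" "v * v = v" "v' * v' = v'" "w * w = w"
    using assms(1) ee ff by auto
  have orth: "v * v' = 0" using assms(1,2) ef fe by auto
  have zero: "p * q = 0" if "p \<in> corner u v" "q \<in> corner v' w" for p q
    using that orth unfolding corner_iff[OF idem(1,2)] corner_iff[OF idem(3,4)]
    by (metis mult.assoc mult_zero_left mult_zero_right)
  have "der x \<in> corner u v" "der y \<in> corner v' w"
    using assms by (auto intro: der_mem)
  then show ?thesis using assms(3,4) by (simp add: zero der_0)
qed

text \<open>
  The defect of the product rule is biadditive, so it suffices that it vanishes on pairs of corners.
\<close>

lemma der_prod: "der (x * y) = der x * y + x * der y"
proof -
  define defect where "defect x y = der (x * y) - (der x * y + x * der y)" for x y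
  have corners: "defect x y = 0"
    if "{u, v, v', w} \<subseteq> {e, f}" "x \<in> corner u v" "y \<in> corner v' w" for u v v' w x y
    using that der_prod_corner[of u v w x y] der_prod_corner_mismatch[of u v v' w x y]
    unfolding defect_def by (cases "v = v'") auto
  have addl: "defect (x + x') y = defect x y + defect x' y"
    and addr: "defect x (y + y') = defect x y + defect x y'" for x x' y y'
    by (simp_all add: defect_def der_add algebra_simps)
  have "defect x y = 0" if "{u, v} \<subseteq> {e, f}" "x \<in> corner u v" for u v x y
  proof -
    have "defect x (v' * y * w) = 0" if "{v', w} \<subseteq> {e, f}" for v' w
      using that \<open>{u, v} \<subseteq> {e, f}\<close> \<open>x \<in> corner u v\<close>
      by (intro corners[of u v v' w]) (auto simp: sandwich_def)
    then have "defect x (e * y * e + e * y * f + f * y * e + f * y * f) = 0"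
      by (simp add: addr)
    then show ?thesis using split[of y] by simp
  qed
  then have "defect (u * x * v) y = 0" if "{u, v} \<subseteq> {e, f}" for u v
    using that by (auto simp: sandwich_def)
  then have "defect (e * x * e + e * x * f + f * x * e + f * x * f) y = 0"
    by (simp add: addl)
  then have "defect x y = 0" using split[of x] by simp
  then show ?thesis by (simp add: defect_def)
qed

lemma tau_pcomm: "tau (pcomm n x) = 0"
proof -
  have "\<phi> (pcomm n x) = der (pcomm n x)"
    unfolding lie_der by (rule additive_derivation_pcomm[symmetric]) (rule der_add der_prod)+
  then show ?thesis by (simp add: der_def)
qed

end

section \<open>Standard Lie n-derivations\<close>

lemma sandwich_annihilate:
  "F ` sandwich u UNIV v = {0} \<longleftrightarrow> (\<forall>m \<in> corner u v. F m = 0)"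
proof
  assume "\<forall>m \<in> corner u v. F m = 0"
  then have "F ` corner u v = (\<lambda>_. 0) ` corner u v" by (intro image_cong) auto
  then show "F ` corner u v = {0}" by (simp add: sandwich_def image_constant_conv)
qed blast

lemma lie_bracket_add_left: "lie_bracket (x + y) s = lie_bracket x s + lie_bracket y s"
  by (simp add: lie_bracket_def algebra_simps)

lemma lie_bracket_product:
  "lie_bracket (x * y) s = lie_bracket x s * y + x * lie_bracket y s"
  by (simp add: lie_bracket_def algebra_simps)

text \<open>
  Scalars commute with every construction above, so all maps are linear and not just additive.
\<close>

context unital_algebra
begin

lemma scale_centre: "z \<in> centre \<Longrightarrow> scale r z \<in> centre"
  by (simp add: centre_def) (metis scale_mult_left scale_mult_right)

lemma scale_lie_bracket: "lie_bracket (scale r x) s = scale r (lie_bracket x s)"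
  by (simp add: lie_bracket_def scale_mult_left scale_mult_right scale_right_diff_distrib
      flip: scale_mult_left scale_mult_right)

lemma scale_sandwich: "u * scale r x * v = scale r (u * x * v)"
  by (simp add: scale_mult_left scale_mult_right flip: scale_mult_left scale_mult_right)

lemma linearI:
  assumes "\<And>x y. g (x + y) = g x + g y" "\<And>r x. g (scale r x) = scale r (g x)"
  shows "module_hom scale scale g"
  using assms by unfold_locales auto

end

lemma (in faithful_idempotent) central_lift_scale:
  assumes "unital_algebra scale" "f * y * f \<in> sandwich f centre f"
  shows "central_lift f (scale r y) = scale r (central_lift f y)"
proof -
  interpret unital_algebra scale by (rule assms(1))
  show ?thesis
    using central_lift[OF assms(2)]
    by (intro central_lift_eqI scale_centre) (simp_all add: scale_sandwich)
qed

lemma (in proper_lie_n_derivation) lift_ee_scale: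
  assumes "unital_algebra scale" "\<And>r x. \<phi> (scale r x) = scale r (\<phi> x)"
  shows "central_lift f (\<phi> (e * scale r x * e)) = scale r (central_lift f (\<phi> (e * x * e)))"
proof -
  interpret unital_algebra scale by (rule assms(1))
  have "f * \<phi> (e * x * e) * f \<in> sandwich f centre f"
    by (rule phi_ee) (simp add: sandwich_def)
  from central_lift_scale[OF assms(1) this] show ?thesis
    by (simp add: assms(2) scale_sandwich)
qed

lemma (in proper_lie_n_derivation) tau_scale:
  assumes "unital_algebra scale" "\<And>r x. \<phi> (scale r x) = scale r (\<phi> x)"
  shows "tau (scale r x) = scale r (tau x)"
proof -
  interpret unital_algebra scale by (rule assms(1))
  show ?thesis
    using lift_ee_scale[OF assms] proper_lie_n_derivation.lift_ee_scale[OF proper_swap assms]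
    by (simp add: tau_def scale_right_distrib)
qed

lemma (in faithful_idempotent) bracket_is_pcomm:
  assumes "m \<in> corner e f" "n \<ge> 2"
  shows "lie_bracket m y \<in> range (pcomm n)"
  using pcomm_ef_last[OF assms, of y] by (metis rangeI)

lemma derivation_corner_ee:
  fixes e f a :: "'a::ring_1"
  assumes ee: "e * e = e" and fe: "f * e = 0" and ef: "e * f = 0"
    and prod: "\<And>x y. h (x * y) = h x * y + x * h y" and a: "e * a = a" "a * e = a"
  shows "f * h a * f = 0"
proof -
  have "a * f = a * (e * f)" by (simp only: mult.assoc[symmetric] a)
  then have af: "a * f = 0" using ef by simp
  have "h a = h e * a + e * h a" using prod[of e a] by (simp only: a)
  then have "f * h a * f = f * (h e * a + e * h a) * f" by (rule arg_cong)
  also have "\<dots> = f * h e * (a * f) + f * e * h a * f"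
    by (simp add: distrib_left distrib_right mult.assoc)
  finally show ?thesis by (simp add: af fe)
qed

theorem corollary2p7:
  fixes scale :: "'r::comm_ring_1 \<Rightarrow> 'a::ring_1 \<Rightarrow> 'a"
    and n :: nat and e f :: 'a and \<phi> :: "'a \<Rightarrow> 'a"
  assumes "n \<ge> 2" and "even n"
    and "unital_algebra scale"
    and "nontrivial_idempotent e" and "f = 1 - e"
    and "torsion_free 2 TYPE('a)" and "torsion_free (n - 1) TYPE('a)"
    and "\<And>x. (\<lambda>m. (e * x * e) * m) ` sandwich e UNIV f = {0} \<Longrightarrow>
              (\<lambda>t. t * (e * x * e)) ` sandwich f UNIV e = {0} \<Longrightarrow> e * x * e = 0"
    and "\<And>x. (\<lambda>m. m * (f * x * f)) ` sandwich e UNIV f = {0} \<Longrightarrow>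
              (\<lambda>t. (f * x * f) * t) ` sandwich f UNIV e = {0} \<Longrightarrow> f * x * f = 0"
    and "lie_n_derivation scale n \<phi>"
  shows "standard scale n \<phi> \<longleftrightarrow>
           (sandwich f (\<phi> ` sandwich e UNIV e) f \<subseteq> sandwich f centre f \<and>
            sandwich e (\<phi> ` sandwich f UNIV f) e \<subseteq> sandwich e centre e) \<and>
           (\<forall>m \<in> sandwich e UNIV f. \<forall>t \<in> sandwich f UNIV e.
              e * \<phi> (t * m) * e + f * \<phi> (m * t) * f \<in> centre)"
proof -
  interpret unital_algebra scale by (rule assms(3))
  have ee: "e * e = e" using assms(4) by (simp add: nontrivial_idempotent_def)
  then have idem: "f * f = f" "e * f = 0" "f * e = 0" "e + f = 1"
    unfolding assms(5) by (simp_all add: algebra_simps)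
  interpret faithful_idempotent e f
  proof
    fix a assume a: "a \<in> corner e e" and ann: "\<And>m. m \<in> corner e f \<Longrightarrow> a * m = 0"
      "\<And>t. t \<in> corner f e \<Longrightarrow> t * a = 0"
    from a obtain x where x: "a = e * x * e" unfolding sandwich_def by (rule imageE)
    show "a = 0"
      unfolding x by (rule assms(8)) (use ann x in \<open>simp_all add: sandwich_annihilate\<close>)
  next
    fix b assume b: "b \<in> corner f f" and ann: "\<And>t. t \<in> corner f e \<Longrightarrow> b * t = 0"
      "\<And>m. m \<in> corner e f \<Longrightarrow> m * b = 0"
    from b obtain x where x: "b = f * x * f" unfolding sandwich_def by (rule imageE)
    show "b = 0"
      unfolding x by (rule assms(9)) (use ann x in \<open>simp_all add: sandwich_annihilate\<close>)
  qed (use ee idem in auto)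
  interpret phi: module_hom scale scale \<phi>
    using assms(10) by (simp add: lie_n_derivation_def)
  have lie: "\<phi> (pcomm n x) = (\<Sum>i=1..n. pcomm n (x(i := \<phi> (x i))))" for x
    using assms(10) by (simp add: lie_n_derivation_def)
  show ?thesis
  proof (intro iffI conjI ballI)
    assume "standard scale n \<phi>"
    then obtain h \<tau> where std: "derivation scale h" "module_hom scale scale \<tau>"
        "range \<tau> \<subseteq> centre" "\<forall>c \<in> range (pcomm n). \<tau> c = 0" "\<forall>x. \<phi> x = h x + \<tau> x"
      unfolding standard_def by (elim conjE exE)
    have h: "h (x * y) = h x * y + x * h y" for x y
      using std(1) by (simp add: derivation_def)
    have phi: "\<phi> x = h x + \<tau> x" for x using std(5) by blast
    have tau: "\<tau> x \<in> centre" for x using std(3) by blast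
    have phi_a: "f * \<phi> a * f = f * \<tau> a * f" if "a \<in> corner e e" for a
      using derivation_corner_ee[OF ee idem(3,2) h, of a] that
      by (simp add: phi mem_ee distrib_left distrib_right)
    have phi_b: "e * \<phi> b * e = e * \<tau> b * e" if "b \<in> corner f f" for b
      using derivation_corner_ee[OF ff idem(2,3) h, of b] that
      by (simp add: phi mem_ff distrib_left distrib_right)
    show "sandwich f (\<phi> ` corner e e) f \<subseteq> sandwich f centre f"
    proof
      fix y assume "y \<in> sandwich f (\<phi> ` corner e e) f"
      then obtain a where "a \<in> corner e e" "y = f * \<phi> a * f"
        unfolding sandwich_def[of f "\<phi> ` corner e e"] by blast
      then show "y \<in> sandwich f centre f"
        using phi_a tau unfolding sandwich_def[of f centre] by blast
    qed
    show "sandwich e (\<phi> ` corner f f) e \<subseteq> sandwich e centre e"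
    proof
      fix y assume "y \<in> sandwich e (\<phi> ` corner f f) e"
      then obtain b where "b \<in> corner f f" "y = e * \<phi> b * e"
        unfolding sandwich_def[of e "\<phi> ` corner f f"] by blast
      then show "y \<in> sandwich e centre e"
        using phi_b tau unfolding sandwich_def[of e centre] by blast
    qed
    fix m t assume m: "m \<in> corner e f" and t: "t \<in> corner f e"
    have mt: "m * t \<in> corner e e" and tm: "t * m \<in> corner f f"
      using m t unfolding mem_ee mem_ff mem_ef mem_fe by (metis mult.assoc)+
    have "\<tau> (lie_bracket m t) = 0"
      using bracket_is_pcomm[OF m assms(1), of t] std(4) by blast
    then have "\<tau> (m * t) = \<tau> (t * m)"
      by (simp add: lie_bracket_def module_hom.diff[OF std(2)])
    moreover have "e * z * e + f * z * f = z" if "z \<in> centre" for z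
    proof -
      have "e * z * e + f * z * f = (e + f) * z"
        by (simp add: mult.assoc centre_commutes[OF that, of e] centre_commutes[OF that, of f]
            absorb distrib_right)
      then show ?thesis by (simp add: idem)
    qed
    ultimately show "e * \<phi> (t * m) * e + f * \<phi> (m * t) * f \<in> centre"
      using phi_a[OF mt] phi_b[OF tm] tau by simp
  next
    assume conds: "(sandwich f (\<phi> ` corner e e) f \<subseteq> sandwich f centre f \<and>
        sandwich e (\<phi> ` corner f f) e \<subseteq> sandwich e centre e) \<and>
        (\<forall>m \<in> corner e f. \<forall>t \<in> corner f e. e * \<phi> (t * m) * e + f * \<phi> (m * t) * f \<in> centre)"
    \<comment> \<open>The off-diagonal part of \<open>\<phi>(e)\<close>, with signs such that \<open>[e, s]\<close> is exactly that part.\<close>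
    define s where "s = e * \<phi> e * f - f * \<phi> e * e"
    define ad where "ad x = lie_bracket x s" for x
    define \<psi> where "\<psi> x = \<phi> x - ad x" for x
    have ad_add: "ad (x + y) = ad x + ad y" and ad_prod: "ad (x * y) = ad x * y + x * ad y"
      and ad_scale: "ad (scale r x) = scale r (ad x)" for x y r
      by (simp_all add: ad_def lie_bracket_add_left lie_bracket_product scale_lie_bracket)
    have psi_scale: "\<psi> (scale r x) = scale r (\<psi> x)" for r x
      by (simp add: \<psi>_def ad_scale phi.scale scale_right_diff_distrib)
    have ad_a: "f * ad a * f = 0" if "a \<in> corner e e" for a
      using derivation_corner_ee[OF ee idem(3,2) ad_prod, of a] that by (simp add: mem_ee)
    have ad_b: "e * ad b * e = 0" if "b \<in> corner f f" for b
      using derivation_corner_ee[OF ff idem(2,3) ad_prod, of b] that by (simp add: mem_ff)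
    interpret psi: proper_lie_n_derivation e f n \<psi>
    proof
      fix x y show "\<psi> (x + y) = \<psi> x + \<psi> y"
        by (simp add: \<psi>_def ad_add phi.add)
    next
      fix x show "\<psi> (pcomm n x) = (\<Sum>i=1..n. pcomm n (x(i := \<psi> (x i))))"
        by (simp del: fun_upd_apply add: \<psi>_def pcomm_entry_diff sum_subtractf lie
            additive_derivation_pcomm[of ad, OF ad_add ad_prod])
    next
      have "\<psi> e = e * \<phi> e * e + f * \<phi> e * f"
        using split[of "\<phi> e"]
        by (simp add: \<psi>_def ad_def s_def lie_bracket_def algebra_simps ee ff ef fe absorb)
      then show "\<psi> e * e = e * \<psi> e"
        by (simp add: algebra_simps ee ff ef fe absorb)
    next
      fix a assume a: "a \<in> corner e e"
      then have "f * \<phi> a * f \<in> sandwich f centre f"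
        using conds by (auto simp: sandwich_def[of f "\<phi> ` corner e e"])
      then show "f * \<psi> a * f \<in> sandwich f centre f"
        using ad_a[OF a] by (simp add: \<psi>_def left_diff_distrib right_diff_distrib)
    next
      fix b assume b: "b \<in> corner f f"
      then have "e * \<phi> b * e \<in> sandwich e centre e"
        using conds by (auto simp: sandwich_def[of e "\<phi> ` corner f f"])
      then show "e * \<psi> b * e \<in> sandwich e centre e"
        using ad_b[OF b] by (simp add: \<psi>_def left_diff_distrib right_diff_distrib)
    next
      fix m t assume m: "m \<in> corner e f" and t: "t \<in> corner f e"
      have "m * t \<in> corner e e" "t * m \<in> corner f f"
        using m t unfolding mem_ee mem_ff mem_ef mem_fe by (metis mult.assoc)+
      then have "e * \<psi> (t * m) * e + f * \<psi> (m * t) * f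
          = e * \<phi> (t * m) * e + f * \<phi> (m * t) * f"
        using ad_a ad_b by (simp add: \<psi>_def left_diff_distrib right_diff_distrib)
      then show "e * \<psi> (t * m) * e + f * \<psi> (m * t) * f \<in> centre"
        using conds m t by simp
    qed (use assms in auto)
    have tau_scale: "psi.tau (scale r x) = scale r (psi.tau x)" for r x
      by (rule psi.tau_scale[OF assms(3) psi_scale])
    have der_scale: "psi.der (scale r x) = scale r (psi.der x)" for r x
      by (simp add: psi.der_def tau_scale psi_scale scale_right_diff_distrib)
    have "module_hom scale scale (\<lambda>x. psi.der x + ad x)"
      by (rule linearI)
        (simp_all add: psi.der_add ad_add der_scale ad_scale scale_right_distrib)
    then have "derivation scale (\<lambda>x. psi.der x + ad x)"
      by (simp add: derivation_def psi.der_prod ad_prod distrib_left distrib_right)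
    moreover have "module_hom scale scale psi.tau"
      by (intro linearI psi.tau_add tau_scale)
    moreover have "\<phi> x = psi.der x + ad x + psi.tau x" for x
      by (simp add: psi.der_def \<psi>_def)
    ultimately show "standard scale n \<phi>"
      unfolding standard_def using assms(10) psi.tau_centre psi.tau_pcomm by blast
  qed
qed

end
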